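(* Let $U=(U_n)_{n\ge 0}$ with $U_n=2^{n+1}-1$, and let $\mathbf{u}\in\{0,1\}^{\mathbb{N}}$ be the characteristic word of $U$, i.e. $\mathbf{u}[n]=1$ if and only if $n\in\{U_j\mid j\ge 0\}$. Then $\mathbf{u}$ is $U$-automatic but its boundary sequence $\partial_{\mathbf{u}}$ is not $U$-automatic.
   Context: For an infinite word $\mathbf{x}$ over a finite alphabet $A$ (indexed from $0$), the boundary sequence is $\partial_{\mathbf{x}}=(\partial_{\mathbf{x}}[n])_{n\ge 1}$ with $\partial_{\mathbf{x}}[n]=\{(\mathbf{x}[i],\mathbf{x}[i+n])\mid i\ge 0\}\subseteq A\times A$. Let $U=(U_n)_{n\ge0}$ be an increasing sequence of integers with $U_0=1$ and $\sup_i U_{i+1}/U_i<\infty$. The greedy $U$-representation $\mathrm{rep}_U(n)$ of $n>0$ is the unique word $c_t\cdots c_0$ of non-negative integers with $c_t\neq 0$, $n=\sum_{i=0}^t c_iU_i$ and $\sum_{i=0}^j c_iU_i<U_{j+1}$ for all $j\le t$; $\mathrm{rep}_U(0)$ is the empty word. The digits used belong to a finite set. A deterministic finite automaton with output (DFAO) is a DFA with an output map $\tau$ from its state set to a finite alphabet; its output $\mathcal{A}(w)$ on a word $w$ is $\tau(q)$ with $q$ the state reached by reading $w$ (left to right) from the initial state. A sequence $\mathbf{y}$ is $U$-automatic if there is a DFAO $\mathcal{A}$ with $\mathbf{y}[n]=\mathcal{A}(\mathrm{rep}_U(n))$ for all $n$ for which $\mathbf{y}[n]$ is defined. *)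

theory Defs
  imports Complex_Main
begin

section \<open>Boundary sequences\<close>

text \<open>The boundary sequence is a sequence indexed by \<open>n \<ge> 1\<close>; the value at \<open>n = 0\<close> is junk
  and no statement may refer to it.\<close>

definition boundary :: "(nat \<Rightarrow> 'a) \<Rightarrow> nat \<Rightarrow> ('a \<times> 'a) set" where
  "boundary x n = {(x i, x (i + n)) | i. i \<ge> 0}"


section \<open>Greedy representations\<close>

text \<open>An increasing sequence of integers starting at 1 is positive, so it is taken in \<^typ>\<open>nat\<close>.\<close>

definition numeration_system :: "(nat \<Rightarrow> nat) \<Rightarrow> bool" where
  "numeration_system U \<longleftrightarrow>
     strict_mono U \<and> U 0 = 1 \<and> bdd_above (range (\<lambda>i. real (U (i + 1)) / real (U i)))"

text \<open>Words are written most significant digit first, so in \<open>w = [c\<^sub>t, \<dots>, c\<^sub>0]\<close> the digit \<open>c\<^sub>i\<close>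
  is \<open>rev w ! i\<close>.\<close>

definition greedy_rep :: "(nat \<Rightarrow> nat) \<Rightarrow> nat \<Rightarrow> nat list \<Rightarrow> bool" where
  "greedy_rep U n w \<longleftrightarrow>
     w \<noteq> [] \<and> hd w \<noteq> 0 \<and>
     n = (\<Sum>i<length w. rev w ! i * U i) \<and>
     (\<forall>j<length w. (\<Sum>i\<le>j. rev w ! i * U i) < U (j + 1))"

definition rep :: "(nat \<Rightarrow> nat) \<Rightarrow> nat \<Rightarrow> nat list" where
  "rep U n = (if n = 0 then [] else (THE w. greedy_rep U n w))"

lemma ex1_greedy_padded:
  fixes U :: "nat \<Rightarrow> nat"
  assumes U: "strict_mono U" "U 0 = 1" and m: "m < U t"
  shows "\<exists>!w. length w = t \<and> m = (\<Sum>i<length w. rev w ! i * U i) \<and>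
           (\<forall>j<length w. (\<Sum>i\<le>j. rev w ! i * U i) < U (j + 1))"
    (is "\<exists>!w. ?P t m w")
  using m
proof (induction t arbitrary: m)
  case 0
  then have "m = 0" using U(2) by simp
  then show ?case by auto
next
  case (Suc t)
  have pos: "U t > 0"
    using U strict_mono_less_eq[OF U(1), of 0 t] by simp
  have sum_rev: "(\<Sum>i<k. rev (c # v) ! i * U i) = (\<Sum>i<k. rev v ! i * U i)"
    if "k \<le> length v" for c v k
    using that by (intro sum.cong) (auto simp: nth_append)
  have Cons: "?P (Suc t) m (c # v) \<longleftrightarrow> c = m div U t \<and> ?P t (m mod U t) v" for c v
  proof (cases "length v = t")
    case True
    have total: "(\<Sum>i<Suc t. rev (c # v) ! i * U i) = c * U t + (\<Sum>i<t. rev v ! i * U i)"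
      using sum_rev[of t v c] True by (simp add: nth_append)
    have small: "(\<Sum>i<t. rev v ! i * U i) < U t"
      if "\<forall>j<t. (\<Sum>i\<le>j. rev v ! i * U i) < U (j + 1)"
      using that U(2) by (cases t) (auto simp: lessThan_Suc_atMost)
    have part: "(\<forall>j<Suc t. (\<Sum>i\<le>j. rev (c # v) ! i * U i) < U (j + 1)) \<longleftrightarrow>
        (\<Sum>i<Suc t. rev (c # v) ! i * U i) < U (t + 1) \<and>
        (\<forall>j<t. (\<Sum>i\<le>j. rev v ! i * U i) < U (j + 1))"
    proof -
      have "(\<Sum>i\<le>j. rev (c # v) ! i * U i) = (\<Sum>i\<le>j. rev v ! i * U i)" if "j < t" for j
        using sum_rev[of "Suc j" v c] that True by (simp only: lessThan_Suc_atMost Suc_le_eq)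
      then show ?thesis by (auto simp: less_Suc_eq lessThan_Suc_atMost)
    qed
    show ?thesis
    proof
      assume A: "?P (Suc t) m (c # v)"
      then have B: "\<forall>j<t. (\<Sum>i\<le>j. rev v ! i * U i) < U (j + 1)"
        using part True by (metis length_Cons)
      have C: "m = c * U t + (\<Sum>i<t. rev v ! i * U i)"
        using A total True by (metis length_Cons)
      show "c = m div U t \<and> ?P t (m mod U t) v"
        using B C small[OF B] True pos by simp
    next
      assume A: "c = m div U t \<and> ?P t (m mod U t) v"
      have C: "m = (\<Sum>i<Suc t. rev (c # v) ! i * U i)"
        unfolding total using A True by (metis div_mult_mod_eq)
      have D: "\<forall>j<Suc t. (\<Sum>i\<le>j. rev (c # v) ! i * U i) < U (j + 1)"
        unfolding part C[symmetric] using A Suc.prems by simp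
      have E: "length (c # v) = Suc t" using True by simp
      show "?P (Suc t) m (c # v)" unfolding E using C D by blast
    qed
  qed auto
  obtain v where v: "?P t (m mod U t) v" and v_uniq: "\<And>v'. ?P t (m mod U t) v' \<Longrightarrow> v' = v"
    using Suc.IH[of "m mod U t"] pos by (meson mod_less_divisor)
  show ?case
  proof (rule ex1I)
    show "?P (Suc t) m ((m div U t) # v)"
      using Cons v by blast
  next
    fix w assume w: "?P (Suc t) m w"
    then obtain c v' where "w = c # v'" by (metis length_Suc_conv)
    then show "w = (m div U t) # v"
      using Cons[of c v'] w v_uniq by blast
  qed
qed

theorem ex1_greedy_rep:
  assumes U: "numeration_system U" and n: "n > 0"
  shows "\<exists>!w. greedy_rep U n w"
proof -
  have mono: "strict_mono U" and U0: "U 0 = 1"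
    using U by (auto simp: numeration_system_def)
  define t where "t = (LEAST t. n < U t)"
  have ex: "n < U (Suc n)"
    using strict_mono_imp_increasing[OF mono, of "Suc n"] by simp
  have t: "n < U t"
    unfolding t_def by (rule LeastI[of _ "Suc n"]) (rule ex)
  have len: "length w = t" if w: "greedy_rep U n w" for w
  proof -
    obtain c v where cv: "w = c # v" "c \<noteq> 0"
      using w by (cases w) (auto simp: greedy_rep_def)
    have split: "n = c * U (length v) + (\<Sum>i<length v. rev w ! i * U i)"
      using w cv(1) by (simp add: greedy_rep_def nth_append)
    then have le: "U (length v) \<le> n"
      using cv(2) by (metis le_add1 le_trans mult_le_mono1 One_nat_def Suc_leI
          mult_1 not_gr_zero)
    have gt: "n < U (Suc (length v))"
      using w cv(1) by (auto simp: greedy_rep_def lessThan_Suc_atMost)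
    have "t \<le> Suc (length v)"
      unfolding t_def by (rule Least_le) (rule gt)
    moreover have "length v < t"
      using le t strict_mono_less[OF mono, of "length v" t] by linarith
    ultimately show ?thesis using cv(1) by simp
  qed
  obtain w where w: "length w = t" "n = (\<Sum>i<length w. rev w ! i * U i)"
      "\<forall>j<length w. (\<Sum>i\<le>j. rev w ! i * U i) < U (j + 1)"
    using ex1_greedy_padded[OF mono U0 t] by blast
  obtain s where s: "t = Suc s" using t n U0 by (cases t) auto
  then obtain c v where cv: "w = c # v" "length v = s"
    using w(1) by (metis length_Suc_conv)
  have "c \<noteq> 0"
  proof
    assume "c = 0"
    then have "n = (\<Sum>i<s. rev w ! i * U i)"
      using w(2) cv by (simp add: nth_append)
    moreover have "(\<Sum>i<s. rev w ! i * U i) < U s"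
      using w(3) U0 cv by (cases s) (auto simp: lessThan_Suc_atMost)
    ultimately have "n < U s" by simp
    then have "t \<le> s" unfolding t_def by (rule Least_le)
    then show False using s by simp
  qed
  then have "greedy_rep U n w"
    using w cv by (auto simp: greedy_rep_def)
  moreover have "w' = w" if "greedy_rep U n w'" for w'
    using ex1_greedy_padded[OF mono U0 t] len[OF that] that w
    unfolding greedy_rep_def by blast
  ultimately show ?thesis by blast
qed


section \<open>Automata with output and automatic sequences\<close>

record ('q, 'a, 'b) dfao =
  states :: "'q set"
  alphabet :: "'a set"
  init :: 'q
  trans_fun :: "'q \<Rightarrow> 'a \<Rightarrow> 'q"
  out :: "'q \<Rightarrow> 'b"

text \<open>The output alphabet is \<open>out A ` states A\<close>, hence finite.\<close>

definition is_dfao :: "('q, 'a, 'b) dfao \<Rightarrow> bool" where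
  "is_dfao A \<longleftrightarrow>
     finite (states A) \<and> finite (alphabet A) \<and> init A \<in> states A \<and>
     (\<forall>q\<in>states A. \<forall>a\<in>alphabet A. trans_fun A q a \<in> states A)"

definition dfao_output :: "('q, 'a, 'b) dfao \<Rightarrow> 'a list \<Rightarrow> 'b" where
  "dfao_output A w = out A (foldl (trans_fun A) (init A) w)"

text \<open>\<open>N\<close> is the set of indices at which the sequence \<open>y\<close> is defined.  Since state sets are
  finite, quantifying over automata with states in \<^typ>\<open>nat\<close> loses no generality
  (see \<open>automaticI\<close> below).\<close>

definition automatic :: "(nat \<Rightarrow> nat) \<Rightarrow> nat set \<Rightarrow> (nat \<Rightarrow> 'b) \<Rightarrow> bool" where
  "automatic U N y \<longleftrightarrow>
     (\<exists>A :: (nat, nat, 'b) dfao. is_dfao A \<and>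
        (\<forall>n\<in>N. rep U n \<in> lists (alphabet A) \<and> y n = dfao_output A (rep U n)))"

lemma automaticI:
  fixes A :: "('q, nat, 'b) dfao"
  assumes A: "is_dfao A"
    and rep: "\<And>n. n \<in> N \<Longrightarrow> rep U n \<in> lists (alphabet A)"
    and y: "\<And>n. n \<in> N \<Longrightarrow> y n = dfao_output A (rep U n)"
  shows "automatic U N y"
proof -
  obtain f :: "'q \<Rightarrow> nat" where f: "inj_on f (states A)"
    using A finite_imp_inj_to_nat_seg[of "states A"] by (auto simp: is_dfao_def)
  define g where "g = inv_into (states A) f"
  have g: "g (f q) = q" if "q \<in> states A" for q
    using f that by (simp add: g_def)
  define B :: "(nat, nat, 'b) dfao" where
    "B = \<lparr>states = f ` states A, alphabet = alphabet A, init = f (init A),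
          trans_fun = (\<lambda>q a. f (trans_fun A (g q) a)), out = (\<lambda>q. out A (g q))\<rparr>"
  have B: "is_dfao B"
    using A by (auto simp: is_dfao_def B_def g)
  have run: "q \<in> states A \<Longrightarrow> foldl (trans_fun A) q w \<in> states A \<and>
      foldl (trans_fun B) (f q) w = f (foldl (trans_fun A) q w)"
    if "w \<in> lists (alphabet A)" for w q
    using that
  proof (induction w arbitrary: q)
    case (Cons a w)
    then have "trans_fun A q a \<in> states A"
      using A by (auto simp: is_dfao_def)
    moreover have "trans_fun B (f q) a = f (trans_fun A q a)"
      using Cons.prems g by (simp add: B_def)
    ultimately show ?case using Cons by auto
  qed simp
  have "dfao_output B w = dfao_output A w" if "w \<in> lists (alphabet A)" for w
    using run[OF that, of "init A"] A g by (simp add: dfao_output_def B_def is_dfao_def)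
  moreover have "alphabet B = alphabet A" by (simp add: B_def)
  ultimately show ?thesis
    unfolding automatic_def using B rep y by metis
qed


section \<open>Characteristic words\<close>

definition char_word :: "(nat \<Rightarrow> nat) \<Rightarrow> nat \<Rightarrow> nat" where
  "char_word U n = (if n \<in> {U j | j. j \<ge> 0} then 1 else 0)"

lemma numeration_system_pow2_minus_1:
  assumes U: "\<And>n. U n = 2 ^ (n + 1) - (1 :: nat)"
  shows "numeration_system U"
proof -
  have Suc: "U (i + 1) = 2 * U i + 1" for i
  proof -
    have "(2::nat) ^ i \<ge> 1" by simp
    then show ?thesis unfolding U power_add power_one_right by linarith
  qed
  have pos: "U i \<ge> 1" for i
  proof -
    have "(2::nat) ^ i \<ge> 1" by simp
    then show ?thesis unfolding U power_add power_one_right by linarith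
  qed
  have "real (U (i + 1)) / real (U i) \<le> 3" for i
    using pos[of i] Suc[of i] by (simp add: divide_simps)
  then have "bdd_above (range (\<lambda>i. real (U (i + 1)) / real (U i)))"
    by (intro bdd_aboveI[of _ 3]) auto
  moreover have "strict_mono U"
    unfolding strict_mono_Suc_iff using Suc by simp
  ultimately show ?thesis
    using U[of 0] by (simp add: numeration_system_def)
qed

end

theory Submission
  imports Defs
begin

text \<open>A nonempty word represents some \<open>U\<^sub>j\<close> iff it has the form \<open>10\<^sup>j\<close>, which a three-state automaton
  detects.  On the other hand \<open>(1, 1)\<close> lies in the boundary set at \<open>n\<close> iff \<open>n\<close> is a difference
  \<open>U\<^sub>j - U\<^sub>i\<close>.  Since \<open>U\<^sub>k + \<dots> + U\<^bsub>k+m-1\<^esub> = U\<^bsub>k+m\<^esub> - U\<^sub>k - m\<close>, the word \<open>1\<^sup>mw\<close>, where \<open>w\<close> is the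
  representation of \<open>r\<close> padded to length \<open>k\<close>, represents \<open>U\<^bsub>k+m\<^esub> - U\<^sub>k + (r - m)\<close>.  For \<open>r = m\<close> this
  is a difference, but for \<open>0 < r - m < 2\<^sup>k\<close> it is not, as its binary expansion is not of the form
  \<open>1\<^sup>b0\<^sup>a\<close>.  Hence an automaton would have to distinguish all the prefixes \<open>1\<^sup>m\<close>.\<close>

text \<open>Drops from \<open>greedy_rep\<close> the condition on the leading digit, so that words
  padded with leading zeros qualify and can be built up digit by digit.\<close>

definition greedy_word :: "(nat \<Rightarrow> nat) \<Rightarrow> nat \<Rightarrow> nat list \<Rightarrow> bool" where
  "greedy_word U n w \<longleftrightarrow>
     n = (\<Sum>i<length w. rev w ! i * U i) \<and>
     (\<forall>j<length w. (\<Sum>i\<le>j. rev w ! i * U i) < U (j + 1))"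

lemma greedy_rep_iff:
  "greedy_rep U n w \<longleftrightarrow> w \<noteq> [] \<and> hd w \<noteq> 0 \<and> greedy_word U n w"
  by (simp add: greedy_rep_def greedy_word_def)

lemma greedy_word_Nil: "greedy_word U 0 []"
  by (simp add: greedy_word_def)

text \<open>A new leading digit leaves all shorter partial sums unchanged, so only the full sum has
  to be compared with the next term of \<open>U\<close>.\<close>

lemma greedy_word_Cons:
  assumes w: "greedy_word U r w"
    and less: "c * U (length w) + r < U (Suc (length w))"
  shows "greedy_word U (c * U (length w) + r) (c # w)"
proof -
  have sum_rev: "(\<Sum>i<k. rev (c # w) ! i * U i) = (\<Sum>i<k. rev w ! i * U i)"
    if "k \<le> length w" for k
    using that by (intro sum.cong) (auto simp: nth_append)
  have total: "(\<Sum>i<Suc (length w). rev (c # w) ! i * U i) = c * U (length w) + r"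
    using w sum_rev[of "length w"] by (simp add: greedy_word_def nth_append)
  moreover have "(\<Sum>i\<le>j. rev (c # w) ! i * U i) < U (j + 1)" if "j < Suc (length w)" for j
  proof (cases "j = length w")
    case True
    then show ?thesis using total less by (simp add: lessThan_Suc_atMost del: sum.atMost_Suc sum.lessThan_Suc rev.simps)
  next
    case False
    then have "j < length w" using that by simp
    then have "(\<Sum>i\<le>j. rev (c # w) ! i * U i) = (\<Sum>i\<le>j. rev w ! i * U i)"
      using sum_rev[of "Suc j"] by (simp only: lessThan_Suc_atMost Suc_le_eq)
    then show ?thesis using w \<open>j < length w\<close> by (simp add: greedy_word_def)
  qed
  ultimately show ?thesis
    by (simp only: greedy_word_def length_Cons) blast
qed

lemma greedy_word_replicate_zero:
  assumes "\<And>i. U i > 0"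
  shows "greedy_word U 0 (replicate k 0)"
proof (induction k)
  case (Suc k)
  then show ?case using greedy_word_Cons[of U 0 "replicate k 0" 0] assms by simp
qed (simp add: greedy_word_Nil)

lemma greedy_word_digit:
  assumes "greedy_word U n w" "c \<in> set w"
  obtains j where "c * U j < U (j + 1)"
proof -
  obtain j where j: "j < length w" "rev w ! j = c"
    using assms(2) by (metis in_set_conv_nth length_rev set_rev)
  have "rev w ! j * U j \<le> (\<Sum>i\<le>j. rev w ! i * U i)"
    by (intro member_le_sum) auto
  also have "\<dots> < U (j + 1)" using assms(1) j(1) by (simp add: greedy_word_def)
  finally show thesis using that j(2) by blast
qed

lemma greedy_rep_rep:
  assumes "numeration_system U" "n > 0"
  shows "greedy_rep U n (rep U n)"
  using theI'[OF ex1_greedy_rep[OF assms]] assms(2) by (simp add: rep_def)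

lemma rep_eqI:
  assumes "numeration_system U" "n > 0" "greedy_rep U n w"
  shows "rep U n = w"
  using ex1_greedy_rep[OF assms(1,2)] greedy_rep_rep[OF assms(1,2)] assms(3) by blast

lemma pair_mem_boundary_iff: "(a, b) \<in> boundary x n \<longleftrightarrow> (\<exists>i. x i = a \<and> x (i + n) = b)"
  by (auto simp: boundary_def)

text \<open>In binary, \<open>2 ^ Suc k * x + d\<close> has a zero at position \<open>k\<close> strictly between two ones.\<close>

lemma not_pow2_difference:
  fixes d k x i j :: nat
  assumes "0 < d" "d < 2 ^ k" "0 < x"
  shows "2 ^ Suc k * x + d + 2 ^ i \<noteq> 2 ^ j"
proof
  assume eq: "2 ^ Suc k * x + d + 2 ^ i = (2 ^ j :: nat)"
  have "(2::nat) ^ Suc k \<le> 2 ^ Suc k * x" using assms(3) by simp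
  then have "(2::nat) ^ Suc k < 2 ^ j" using eq assms(1) by linarith
  then have "Suc k < j" by (metis one_less_numeral_iff power_strict_increasing_iff semiring_norm(76))
  \<comment> \<open>Modulo \<open>2 ^ Suc k\<close> only \<open>d + 2 ^ i\<close> survives, so it
    must vanish there. For \<open>k \<le> i\<close> this would make \<open>2 ^ k\<close> divide
    \<open>d\<close>; for \<open>i < k\<close> the sum is positive but too small.\<close>
  then have dvd_j: "(2::nat) ^ Suc k dvd 2 ^ j" by (intro le_imp_power_dvd) simp
  have dvd: "2 ^ Suc k dvd d + 2 ^ i"
    using dvd_j unfolding eq[symmetric] by (metis add.assoc dvd_add_right_iff dvd_triv_left)
  show False
  proof (cases "k \<le> i")
    case True
    then have "(2::nat) ^ k dvd 2 ^ i" by (simp add: le_imp_power_dvd)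
    moreover have "2 ^ k dvd d + 2 ^ i" using dvd by (rule power_le_dvd) simp
    ultimately have "2 ^ k dvd d" by (metis dvd_add_left_iff)
    then show False using assms(1,2) by (auto dest: dvd_imp_le)
  next
    case False
    then have "(2::nat) ^ i \<le> 2 ^ k" by simp
    then have "d + 2 ^ i < 2 ^ Suc k" using assms(2) unfolding power_Suc by linarith
    then show False using dvd assms(1) by (auto dest: dvd_imp_le)
  qed
qed

locale pow2_minus_1_system =
  fixes U :: "nat \<Rightarrow> nat"
  assumes U: "U n = 2 ^ (n + 1) - 1"
begin

lemma numeration_system: "numeration_system U"
  using U by (rule numeration_system_pow2_minus_1)

lemma Suc_U: "Suc (U n) = 2 ^ (n + 1)"
  by (simp add: U)

lemma U_pos: "U n > 0"
  using Suc_U[of n] one_less_power[of "2::nat" "n + 1"] by linarith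

lemma U_Suc: "U (Suc n) = 2 * U n + 1"
  using Suc_U[of n] Suc_U[of "Suc n"] by simp

lemma rep_U: "rep U (U j) = 1 # replicate j 0"
proof (rule rep_eqI[OF numeration_system U_pos])
  show "greedy_rep U (U j) (1 # replicate j 0)"
    using greedy_word_Cons[OF greedy_word_replicate_zero[of U j, OF U_pos], of 1] U_Suc[of j]
    by (simp add: greedy_rep_iff)
qed

lemma rep_eq_one_zeros_iff: "rep U n = 1 # replicate j 0 \<longleftrightarrow> n = U j"
proof
  assume rep: "rep U n = 1 # replicate j 0"
  then have "n > 0" by (auto simp: rep_def intro: gr0I)
  then have "greedy_rep U n (1 # replicate j 0)"
    using greedy_rep_rep[OF numeration_system] rep by metis
  moreover have "greedy_rep U (U j) (1 # replicate j 0)"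
    using greedy_rep_rep[OF numeration_system U_pos[of j]] rep_U by metis
  ultimately show "n = U j" by (simp add: greedy_rep_def)
qed (simp add: rep_U)

lemma rep_digits: "rep U n \<in> lists {0, 1, 2}"
proof (cases "n = 0")
  case False
  then have "greedy_word U n (rep U n)"
    using greedy_rep_rep[OF numeration_system] by (simp add: greedy_rep_iff)
  have "c \<in> {0, 1, 2}" if c: "c \<in> set (rep U n)" for c
  proof -
    obtain j where "c * U j < U (j + 1)"
      using greedy_word_digit[OF \<open>greedy_word U n (rep U n)\<close> c] by blast
    \<comment> \<open>As \<open>U j\<close> is at least 1, \<open>U (j + 1) = 2 * U j + 1\<close> is
      at most \<open>3 * U j\<close>.\<close>
    then have "c * U j < 3 * U j"
      using U_pos[of j] U_Suc[of j] unfolding Suc_eq_plus1[symmetric] by linarith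
    then have "c < 3" using mult_less_cancel2 by blast
    then show ?thesis by auto
  qed
  then show ?thesis by blast
qed (simp add: rep_def)

lemma char_word_eq_1_iff: "char_word U n = 1 \<longleftrightarrow> (\<exists>j. n = U j)"
  by (auto simp: char_word_def)

text \<open>State 1 is reached exactly by the words \<open>10\<^sup>j\<close>; state 2 is a sink.\<close>

definition char_word_dfao :: "(nat, nat, nat) dfao" where
  "char_word_dfao = \<lparr>states = {0, 1, 2}, alphabet = {0, 1, 2}, init = 0,
     trans_fun = (\<lambda>q a. if q + a = 1 then 1 else 2), out = (\<lambda>q. if q = 1 then 1 else 0)\<rparr>"

lemma dfao_output_char_word_dfao:
  "dfao_output char_word_dfao w = (if \<exists>j. w = 1 # replicate j 0 then 1 else 0)"
proof -
  \<comment> \<open>The condition \<open>q + a = 1\<close> holds in just two cases: digit 1 in state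
    0 and digit 0 in state 1.\<close>
  let ?t = "\<lambda>q a :: nat. if q + a = 1 then 1 else 2 :: nat"
  have sink: "foldl ?t 2 v = 2" for v by (induction v) auto
  have one: "foldl ?t 1 v = 1 \<longleftrightarrow> v = replicate (length v) 0" for v
    using sink by (induction v) auto
  have "foldl ?t 0 w = 1 \<longleftrightarrow> (\<exists>j. w = 1 # replicate j 0)"
  proof (cases w)
    case (Cons a v)
    have "(\<exists>j. w = 1 # replicate j 0) \<longleftrightarrow> a = 1 \<and> v = replicate (length v) 0"
      unfolding Cons by (metis length_replicate list.inject)
    then show ?thesis using sink[of v] one[of v] by (simp add: Cons)
  qed simp
  then show ?thesis by (simp add: dfao_output_def char_word_dfao_def)
qed

lemma automatic_char_word: "automatic U UNIV (char_word U)"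
proof (rule automaticI)
  show "is_dfao char_word_dfao" by (simp add: is_dfao_def char_word_dfao_def)
  show "rep U n \<in> lists (alphabet char_word_dfao)" for n
    using rep_digits by (simp add: char_word_dfao_def)
  show "char_word U n = dfao_output char_word_dfao (rep U n)" for n
    unfolding dfao_output_char_word_dfao rep_eq_one_zeros_iff by (auto simp: char_word_def)
qed

text \<open>Induction on \<open>m\<close>: a prepended 1 adds \<open>U (length w + m)\<close>, one
  less than the gap to the next term of \<open>U\<close>, so the deficit grows by one. The bound on
  \<open>n\<close> keeps the word greedy, since twice a term of \<open>U\<close> is below the next.
  The identity is additive to avoid truncated subtraction.\<close>

lemma greedy_word_ones:
  assumes "greedy_word U r w" "r \<le> U (length w)"
  obtains n where "greedy_word U n (replicate m 1 @ w)" "n \<le> U (length w + m)"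
    "n + U (length w) + m = U (length w + m) + r"
proof -
  have "\<exists>n. greedy_word U n (replicate m 1 @ w) \<and> n \<le> U (length w + m) \<and>
      n + U (length w) + m = U (length w + m) + r"
  proof (induction m)
    case 0
    then show ?case using assms by auto
  next
    case (Suc m)
    then obtain n where n: "greedy_word U n (replicate m 1 @ w)" "n \<le> U (length w + m)"
      "n + U (length w) + m = U (length w + m) + r" by blast
    have "greedy_word U (U (length w + m) + n) (replicate (Suc m) 1 @ w)"
      using greedy_word_Cons[OF n(1), of 1] n(2) U_Suc[of "length w + m"]
      by (simp add: add.commute)
    then show ?case using n(2,3) U_Suc[of "length w + m"]
      by (intro exI[of _ "U (length w + m) + n"]) simp
  qed
  then show thesis using that by blast
qed

lemma mem_boundary_iff: "(1, 1) \<in> boundary (char_word U) n \<longleftrightarrow> (\<exists>i j. U i + n = U j)"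
  unfolding pair_mem_boundary_iff char_word_eq_1_iff by metis

text \<open>The words \<open>1\<^sup>p\<close> and \<open>1\<^sup>q\<close> are separated by the padded representation of \<open>q\<close>.\<close>

lemma separating_word:
  assumes "0 < p" "p < q"
  obtains w n n' where "rep U n = replicate p 1 @ w" "rep U n' = replicate q 1 @ w"
    "0 < n" "0 < n'" "(1, 1) \<notin> boundary (char_word U) n" "(1, 1) \<in> boundary (char_word U) n'"
proof -
  \<comment> \<open>Padded length \<open>q\<close> suffices both to represent \<open>q\<close>
    itself and to ensure \<open>q - p < 2 ^ q\<close> at the end.\<close>
  have "q < 2 ^ q" by (rule less_exp)
  then have "q < U q" using Suc_U[of q] unfolding power_add power_one_right by linarith
  have "strict_mono U" "U 0 = 1"
    using numeration_system by (simp_all add: numeration_system_def)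
  then obtain w where w: "length w = q" "greedy_word U q w"
    using ex1_greedy_padded[of U q q] \<open>q < U q\<close> unfolding greedy_word_def by blast
  have rep: "\<exists>n>0. rep U n = replicate m 1 @ w \<and> n + U q + m = U (q + m) + q"
    if "0 < m" "m \<le> q" for m
  proof -
    obtain n where n: "greedy_word U n (replicate m 1 @ w)" "n + U q + m = U (q + m) + q"
      using greedy_word_ones[OF w(2), of m] w(1) \<open>q < U q\<close> by auto
    have "U q < U (q + m)" using \<open>strict_mono U\<close> that(1) by (simp add: strict_mono_less)
    then have "n > 0" using n(2) that(2) by linarith
    moreover have "greedy_rep U n (replicate m 1 @ w)"
      using n(1) that(1) by (cases m) (auto simp: greedy_rep_iff)
    ultimately show ?thesis using rep_eqI[OF numeration_system] n(2) by blast
  qed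
  obtain n where n: "n > 0" "rep U n = replicate p 1 @ w" "n + U q + p = U (q + p) + q"
    using rep[of p] assms by auto
  obtain n' where n': "n' > 0" "rep U n' = replicate q 1 @ w" "n' + U q + q = U (q + q) + q"
    using rep[of q] assms by auto
  have "U q + n' = U (q + q)" using n'(3) by linarith
  then have in': "(1, 1) \<in> boundary (char_word U) n'" unfolding mem_boundary_iff by blast
  have "(1, 1) \<notin> boundary (char_word U) n"
  proof
    assume "(1, 1) \<in> boundary (char_word U) n"
    then obtain i j where ij: "U i + n = U j" unfolding mem_boundary_iff by blast
    \<comment> \<open>In binary, \<open>n\<close> turns out to be a block of \<open>p\<close> ones
      from bit \<open>q + 1\<close> upwards, a zero at bit \<open>q\<close>, and the nonzero number
      \<open>q - p\<close> below it.\<close>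
    have "(2::nat) ^ (q + p + 1) = 2 ^ Suc q * (2 ^ p - 1) + 2 ^ Suc q"
      by (simp add: power_add algebra_simps)
    moreover have "n + 2 ^ (q + 1) + p = 2 ^ (q + p + 1) + q"
      using n(3) Suc_U[of q] Suc_U[of "q + p"] by linarith
    ultimately have "n = 2 ^ Suc q * (2 ^ p - 1) + (q - p)"
      using assms(2) by simp
    \<comment> \<open>The subtracted ones in \<open>U i\<close> and \<open>U j\<close> cancel, which
      leaves powers of two with exponents raised by one.\<close>
    then have "2 ^ Suc q * (2 ^ p - 1) + (q - p) + 2 ^ (i + 1) = 2 ^ (j + 1)"
      using ij Suc_U[of i] Suc_U[of j] by linarith
    moreover have "0 < (2::nat) ^ p - 1" using one_less_power[of "2::nat" p] assms(1) by simp
    ultimately show False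
      using not_pow2_difference[of "q - p" q "2 ^ p - 1" "i + 1" "j + 1"] assms \<open>q < 2 ^ q\<close>
      by linarith
  qed
  then show thesis using that n n' in' by blast
qed

text \<open>Pigeonhole: two words \<open>1\<^sup>p\<close> and \<open>1\<^sup>q\<close> reach the
  same state, so no common suffix can separate their outputs.\<close>

lemma not_automatic_boundary: "\<not> automatic U {1..} (boundary (char_word U))"
proof
  assume "automatic U {1..} (boundary (char_word U))"
  then obtain A :: "(nat, nat, (nat \<times> nat) set) dfao" where A: "is_dfao A"
    and alph: "\<And>n. n > 0 \<Longrightarrow> rep U n \<in> lists (alphabet A)"
    and out: "\<And>n. n > 0 \<Longrightarrow> boundary (char_word U) n = dfao_output A (rep U n)"
    unfolding automatic_def by (auto simp: Suc_le_eq)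
  \<comment> \<open>The alphabet of \<open>A\<close> is only known to contain the digits of
    representations; the digit 1 occurs in that of \<open>U 0\<close>.\<close>
  have "1 \<in> alphabet A" using alph[OF U_pos[of 0]] by (simp add: rep_U)
  define f where "f m = foldl (trans_fun A) (init A) (replicate m 1)" for m
  have "foldl (trans_fun A) q v \<in> states A" if "q \<in> states A" "v \<in> lists (alphabet A)" for q v
    using that A by (induction v arbitrary: q) (auto simp: is_dfao_def)
  then have "f m \<in> states A" for m
    using A \<open>1 \<in> alphabet A\<close> by (auto simp: f_def is_dfao_def in_lists_conv_set)
  \<comment> \<open>The index 0 is left out because \<open>separating_word\<close> requires
    \<open>p\<close> to be positive.\<close>
  then have "f ` {1..} \<subseteq> states A" by blast
  then have "\<not> inj_on f {1..}"
    using A infinite_Ici[of "1::nat"] finite_subset finite_imageD unfolding is_dfao_def by metis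
  then obtain p q where pq: "0 < p" "p < q" "f p = f q"
    unfolding inj_on_def by (metis atLeast_iff less_le_trans linorder_neqE_nat zero_less_one)
  obtain w n n' where "rep U n = replicate p 1 @ w" "rep U n' = replicate q 1 @ w"
    "0 < n" "0 < n'" and sep: "(1, 1) \<notin> boundary (char_word U) n" "(1, 1) \<in> boundary (char_word U) n'"
    using separating_word pq(1,2) by metis
  then have "boundary (char_word U) n = boundary (char_word U) n'"
    using pq(3) out by (simp add: dfao_output_def f_def)
  then show False using sep by simp
qed

end

theorem proposition3p13:
  fixes U :: "nat \<Rightarrow> nat"
  assumes "\<And>n. U n = 2 ^ (n + 1) - 1"
  shows "automatic U UNIV (char_word U) \<and> \<not> automatic U {1..} (boundary (char_word U))"
proof -
  interpret pow2_minus_1_system U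
    using assms by unfold_locales
  show ?thesis using automatic_char_word not_automatic_boundary by blast
qed

end
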